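(* Let $\Omega$ be a compact metrizable space and let $J$ be an M-ideal of $C(\Omega)$. Then the pair $(C(\Omega),J)$ has the quotient lifting property (QLP).
   Context: $C(\Omega)$ is the space of continuous scalar-valued functions on $\Omega$ with the sup norm. A closed subspace $J$ of a Banach space $X$ is an M-ideal if its annihilator $J^\perp$ is an L-summand of $X^*$, i.e. there is a linear projection $P$ of $X^*$ onto $J^\perp$ with $\|x^*\|=\|Px^*\|+\|x^*-Px^*\|$ for all $x^*\in X^*$. For a closed subspace $J$ of a Banach space $X$, with quotient map $\pi:X\to X/J$, the pair $(X,J)$ has the quotient lifting property (QLP) if for every Banach space $Y$ and every bounded linear operator $S:Y\to X/J$ there is a bounded linear operator $T:Y\to X$ with $\pi\circ T=S$ and $\|T\|=\|S\|$. *)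

theory Defs
  imports "HOL-Analysis.Analysis"
begin

text \<open>
  The classes \<^class>\<open>real_normed_vector\<close> and \<^class>\<open>banach\<close> only know about real scalars. A normed
  (Banach) space over the scalar field \<open>'k\<close>, where \<open>'k\<close> is \<^typ>\<open>real\<close> or \<^typ>\<open>complex\<close>, is a type of
  the respective class together with a scalar multiplication \<open>'k \<Rightarrow> 'v \<Rightarrow> 'v\<close> that extends the
  real one and for which the norm is homogeneous. For \<open>'k = real\<close> it is necessarily \<^term>\<open>scaleR\<close>.
\<close>

locale normed_space_over = vector_space scale
  for scale :: "'k::real_normed_field \<Rightarrow> 'v::real_normed_vector \<Rightarrow> 'v" +
  assumes scale_of_real: "scale (of_real r) v = r *\<^sub>R v"
    and norm_scale: "norm (scale a v) = norm a * norm v"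

lemma normed_space_over_real_iff:
  "normed_space_over (s :: real \<Rightarrow> 'v::real_normed_vector \<Rightarrow> 'v) \<longleftrightarrow> s = scaleR"
proof
  assume "normed_space_over s"
  then show "s = scaleR"
    using normed_space_over.scale_of_real[of s] by (auto simp: fun_eq_iff)
next
  assume "s = scaleR"
  then show "normed_space_over s"
    by (auto intro!: normed_space_over.intro normed_space_over_axioms.intro
        real_vector.vector_space_axioms)
qed


subsection \<open>M-ideals\<close>

definition dual_space ::
    "('k::real_normed_field \<Rightarrow> 'x::real_normed_vector \<Rightarrow> 'x) \<Rightarrow> ('x \<Rightarrow>\<^sub>L 'k) set" where
  "dual_space s = {\<phi>. \<forall>a x. blinfun_apply \<phi> (s a x) = a * blinfun_apply \<phi> x}"

definition dual_scale ::
    "'k::real_normed_field \<Rightarrow> ('x::real_normed_vector \<Rightarrow>\<^sub>L 'k) \<Rightarrow> ('x \<Rightarrow>\<^sub>L 'k)" where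
  "dual_scale a \<phi> = blinfun_mult_right a o\<^sub>L \<phi>"

definition annihilator ::
    "('k::real_normed_field \<Rightarrow> 'x::real_normed_vector \<Rightarrow> 'x) \<Rightarrow> 'x set \<Rightarrow> ('x \<Rightarrow>\<^sub>L 'k) set" where
  "annihilator s J = {\<phi> \<in> dual_space s. \<forall>x\<in>J. blinfun_apply \<phi> x = 0}"

text \<open>
  In \<open>L_summand s V W\<close> the ambient normed space is the subspace \<open>V\<close> of the type \<open>'v\<close>; the values
  of the projection outside \<open>V\<close> are irrelevant.
\<close>

definition L_summand ::
    "('k::real_normed_field \<Rightarrow> 'v::real_normed_vector \<Rightarrow> 'v) \<Rightarrow> 'v set \<Rightarrow> 'v set \<Rightarrow> bool" where
  "L_summand s V W \<longleftrightarrow> (\<exists>P :: 'v \<Rightarrow> 'v.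
     (\<forall>u\<in>V. \<forall>v\<in>V. P (u + v) = P u + P v) \<and>
     (\<forall>a. \<forall>v\<in>V. P (s a v) = s a (P v)) \<and>
     P ` V = W \<and> (\<forall>v\<in>V. P (P v) = P v) \<and>
     (\<forall>v\<in>V. norm v = norm (P v) + norm (v - P v)))"

definition M_ideal ::
    "('k::real_normed_field \<Rightarrow> 'x::real_normed_vector \<Rightarrow> 'x) \<Rightarrow> 'x set \<Rightarrow> bool" where
  "M_ideal s J \<longleftrightarrow>
     module.subspace s J \<and> closed J \<and> L_summand dual_scale (dual_space s) (annihilator s J)"


subsection \<open>Quotients and the quotient lifting property\<close>

text \<open>
  Elements of \<open>X/J\<close> are the cosets \<^term>\<open>x +o J\<close>, added by elementwise addition of sets. The
  summand \<open>J\<close> in \<open>quot_scale\<close> only matters for the scalar \<open>0\<close>.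
\<close>

definition quot_carrier :: "'x::real_normed_vector set \<Rightarrow> 'x set set" where
  "quot_carrier J = range (\<lambda>x. x +o J)"

definition quot_scale ::
    "('k \<Rightarrow> 'x::real_normed_vector \<Rightarrow> 'x) \<Rightarrow> 'x set \<Rightarrow> 'k \<Rightarrow> 'x set \<Rightarrow> 'x set" where
  "quot_scale s J a A = s a ` A + J"

definition quot_norm :: "'x::real_normed_vector set \<Rightarrow> real" where
  "quot_norm A = (INF x\<in>A. norm x)"

lemma
  fixes s :: "'k::real_normed_field \<Rightarrow> 'x::real_normed_vector \<Rightarrow> 'x"
  assumes "module s" and "module.subspace s J"
  shows quot_add_coset: "(x +o J) + (y +o J) = (x + y) +o J"
    and quot_scale_coset: "quot_scale s J a (x +o J) = s a x +o J"
proof -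
  interpret module s by fact
  have coset: "v +o A = (+) v ` A" for v :: 'x and A
    by (auto simp: elt_set_plus_def)
  have J: "0 \<in> J" "\<And>u v. u \<in> J \<Longrightarrow> v \<in> J \<Longrightarrow> u + v \<in> J" "\<And>a u. u \<in> J \<Longrightarrow> s a u \<in> J"
    using assms(2) by (auto simp: subspace_def)
  have JJ: "J + J = J"
    using J by (force simp: set_plus_def)
  then show "(x +o J) + (y +o J) = (x + y) +o J"
    by (simp add: set_plus_rearrange)
  have "s a ` J + J = J"
    using J by (force simp: set_plus_def image_iff intro: exI[of _ 0])
  moreover have "s a ` (x +o J) = s a x +o (s a ` J)"
    by (simp add: coset image_image scale_right_distrib)
  ultimately show "quot_scale s J a (x +o J) = s a x +o J"
    by (simp add: quot_scale_def set_plus_rearrange3)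
qed

definition bounded_linear_to_quot ::
    "('k \<Rightarrow> 'y::real_normed_vector \<Rightarrow> 'y) \<Rightarrow> ('k \<Rightarrow> 'x::real_normed_vector \<Rightarrow> 'x) \<Rightarrow> 'x set \<Rightarrow>
     ('y \<Rightarrow> 'x set) \<Rightarrow> bool" where
  "bounded_linear_to_quot sY sX J S \<longleftrightarrow>
     range S \<subseteq> quot_carrier J \<and>
     (\<forall>y z. S (y + z) = S y + S z) \<and>
     (\<forall>a y. S (sY a y) = quot_scale sX J a (S y)) \<and>
     (\<exists>K. \<forall>y. quot_norm (S y) \<le> norm y * K)"

text \<open>The counterpart of \<^const>\<open>onorm\<close> for operators with values in a quotient.\<close>

definition quot_onorm :: "('y::real_normed_vector \<Rightarrow> 'x::real_normed_vector set) \<Rightarrow> real" where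
  "quot_onorm S = (SUP y. quot_norm (S y) / norm y)"

text \<open>
  A definition cannot quantify over types, so the type \<open>'y\<close> underlying the Banach spaces \<open>Y\<close> is a
  parameter. A theorem concluding \<open>QLP TYPE('y) s J\<close> for a free type variable \<open>'y\<close> is the property
  for all Banach spaces.
\<close>

definition QLP ::
    "'y::banach itself \<Rightarrow> ('k::real_normed_field \<Rightarrow> 'x::real_normed_vector \<Rightarrow> 'x) \<Rightarrow> 'x set \<Rightarrow> bool" where
  "QLP _ sX J \<longleftrightarrow>
     (\<forall>(sY :: 'k \<Rightarrow> 'y \<Rightarrow> 'y) S. normed_space_over sY \<and> bounded_linear_to_quot sY sX J S \<longrightarrow>
       (\<exists>T. bounded_linear T \<and> Vector_Spaces.linear sY sX T \<and>
            (\<forall>y. T y +o J = S y) \<and> onorm T = quot_onorm S))"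


subsection \<open>Scalar multiplication on spaces of continuous functions\<close>

text \<open>
  For compact \<open>'a\<close>, the type \<^typ>\<open>'a::topological_space \<Rightarrow>\<^sub>C 'k::real_normed_field\<close> of bounded
  continuous functions with its sup norm is the space \<open>C('a)\<close> of \<open>'k\<close>-valued continuous functions.
\<close>

definition bcontfun_scale ::
    "'k::real_normed_field \<Rightarrow> ('a::topological_space \<Rightarrow>\<^sub>C 'k) \<Rightarrow> ('a \<Rightarrow>\<^sub>C 'k)" where
  "bcontfun_scale a f = Bcontfun (\<lambda>x. a * apply_bcontfun f x)"

lemma apply_bcontfun_scale: "apply_bcontfun (bcontfun_scale a f) x = a * apply_bcontfun f x"
proof -
  have "bounded ((*) a ` range (apply_bcontfun f))"
    by (intro bounded_linear_image bounded_linear_mult_right bounded_apply_bcontfun)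
  then have "(\<lambda>x. a * apply_bcontfun f x) \<in> bcontfun"
    by (auto simp: bcontfun_def image_image intro!: continuous_intros)
  then show ?thesis
    by (simp add: bcontfun_scale_def Bcontfun_inverse)
qed

lemma bcontfun_eq_continuous:
  assumes "compact (UNIV :: 'a::topological_space set)"
  shows "range (apply_bcontfun :: ('a \<Rightarrow>\<^sub>C 'k::real_normed_field) \<Rightarrow> _) = {f. continuous_on UNIV f}"
  using assms apply_bcontfun_cases
  by (fastforce simp: bcontfun_def intro: compact_imp_bounded compact_continuous_image)

lemma normed_space_over_bcontfun_scale:
  "normed_space_over
     (bcontfun_scale :: 'k::real_normed_field \<Rightarrow> ('a::topological_space \<Rightarrow>\<^sub>C 'k) \<Rightarrow> _)"
proof unfold_locales
  fix a :: 'k and f :: "'a \<Rightarrow>\<^sub>C 'k"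
  have le: "norm (bcontfun_scale b g) \<le> norm b * norm g" for b :: 'k and g :: "'a \<Rightarrow>\<^sub>C 'k"
    by (rule norm_bound)
      (simp add: apply_bcontfun_scale norm_mult mult_left_mono norm_bounded)
  show "norm (bcontfun_scale a f) = norm a * norm f"
  proof (cases "a = 0")
    case True
    then show ?thesis using le[of a f] by simp
  next
    case False
    have "bcontfun_scale (inverse a) (bcontfun_scale a f) = f"
      using False by (intro bcontfun_eqI) (simp add: apply_bcontfun_scale)
    then have "norm f \<le> norm (inverse a) * norm (bcontfun_scale a f)"
      using le[of "inverse a" "bcontfun_scale a f"] by simp
    then have "norm a * norm f \<le> norm (bcontfun_scale a f)"
      using False by (simp add: norm_inverse norm_divide field_simps)
    then show ?thesis using le[of a f] by simp
  qed
qed (auto intro!: bcontfun_eqI simp: apply_bcontfun_scale algebra_simps scaleR_conv_of_real)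

end

theory Submission
  imports Defs
begin

text \<open>
  The proof identifies \<open>J\<close> with the functions vanishing on a closed set \<open>D\<close> and then lifts with a
  linear extension operator from \<open>C(D)\<close> to \<open>C(\<Omega>)\<close> of norm at most one.

  An M-ideal \<open>J\<close> is an ideal of the algebra \<open>C(\<Omega>)\<close>. Let \<open>P\<close> be the L-projection onto the annihilator,
  let \<open>\<phi>\<close> annihilate \<open>J\<close>, and let \<open>h\<close> be a function with values in \<open>[0, 1]\<close>. Write \<open>\<mu> = h \<phi>\<close> and
  \<open>\<nu> = (1 - h) \<phi>\<close>. In the dual of \<open>C(\<Omega>)\<close> one has \<open>\<parallel>\<mu>\<parallel> + \<parallel>\<nu>\<parallel> \<le> \<parallel>\<phi>\<parallel>\<close>, while \<open>P \<mu> + P \<nu> = \<phi>\<close>. Hence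
  \<open>\<parallel>\<phi>\<parallel> \<ge> \<parallel>P \<mu>\<parallel> + \<parallel>P \<nu>\<parallel> + \<parallel>\<mu> - P \<mu>\<parallel> + \<parallel>\<nu> - P \<nu>\<parallel> \<ge> \<parallel>\<phi>\<parallel> + \<parallel>\<mu> - P \<mu>\<parallel>\<close>, so \<open>\<mu> = P \<mu>\<close> again annihilates
  \<open>J\<close> (\<open>mult_functional_in_annihilator\<close>). By Hahn--Banach, \<open>h f \<in> J\<close> for \<open>f \<in> J\<close>, and arbitrary
  multipliers are linear combinations of such \<open>h\<close> (\<open>M_ideal_imp_ideal\<close>). This avoids both the Riesz
  representation theorem and extreme points. A closed ideal consists of all functions vanishing on
  its common zero set \<open>D\<close> (\<open>closed_ideal_eq_vanishing\<close>).

  For the extension operator, let \<open>p\<^sub>0, p\<^sub>1, \<dots>\<close> be dense in \<open>D\<close> and extend \<open>f\<close> to a point \<open>x\<close> outside \<open>D\<close>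
  by the weighted mean of the values \<open>f p\<^sub>n\<close> with weights \<open>2\<^sup>-\<^sup>n max 0 (2 dist(x, D) - d(x, p\<^sub>n))\<close>. Only
  points of \<open>D\<close> within twice the distance from \<open>x\<close> to \<open>D\<close> contribute, which gives continuity at the boundary of
  \<open>D\<close>; being a mean, the extension does not increase the sup norm (\<open>linear_extension_operator\<close>).

  Applying this operator \<open>E\<close> to any representative of the coset \<open>S y\<close> defines the lifting: \<open>E\<close> kills \<open>J\<close>
  and maps each function into its own coset, so \<open>E f\<close> is a norm-minimal element of the coset of \<open>f\<close>
  that depends linearly on it (\<open>QLP_if_contractive_lifting\<close>).

  Real and complex scalars are treated together, in the locale \<open>real_or_complex\<close>.
\<close>

section \<open>The Hahn--Banach theorem\<close>

definition sublinear :: "('v::real_vector \<Rightarrow> real) \<Rightarrow> bool" where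
  "sublinear p \<longleftrightarrow> (\<forall>u v. p (u + v) \<le> p u + p v) \<and> (\<forall>t\<ge>0. \<forall>v. p (t *\<^sub>R v) = t * p v)"

text \<open>
  For positive homogeneity an inequality is enough: applying it to \<open>t\<close> and to \<open>1/t\<close> gives equality.
\<close>

lemma sublinearI:
  fixes p :: "'v::real_vector \<Rightarrow> real"
  assumes add: "\<And>u v. p (u + v) \<le> p u + p v"
    and scale: "\<And>t v. t > 0 \<Longrightarrow> p (t *\<^sub>R v) \<le> t * p v"
  shows "sublinear p"
proof -
  have zero: "p 0 = 0"
    using add[of 0 0] scale[of "1/2" 0] by simp
  have "p (t *\<^sub>R v) = t * p v" if "t \<ge> 0" for t v
  proof (cases "t = 0")
    case False
    with that have t: "t > 0" by simp
    have "p v \<le> inverse t * p (t *\<^sub>R v)"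
      using scale[of "inverse t" "t *\<^sub>R v"] t by simp
    then have "t * p v \<le> p (t *\<^sub>R v)"
      using t by (simp add: field_simps)
    with scale[OF t, of v] show ?thesis by simp
  qed (simp add: zero)
  with add show ?thesis by (simp add: sublinear_def)
qed

lemma sublinear_add: "sublinear p \<Longrightarrow> p (u + v) \<le> p u + p v"
  and sublinear_scale: "sublinear p \<Longrightarrow> t \<ge> 0 \<Longrightarrow> p (t *\<^sub>R v) = t * p v"
  and sublinear_zero: "sublinear p \<Longrightarrow> p 0 = 0"
  by (auto simp: sublinear_def dest: spec[of _ 0])

lemma sublinear_minus: "sublinear p \<Longrightarrow> - p (- v) \<le> p v"
  using sublinear_add[of p v "- v"] sublinear_zero[of p] by simp

text \<open>
  The infimum of a family of functionals is sublinear when the family is directed in a weak sense: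
  each instance of sublinearity may switch to another index. The infimum over a chain and the one in
  \<open>sublinear_lower_in_direction\<close> are both of this form.
\<close>

lemma sublinear_INF:
  fixes F :: "'i \<Rightarrow> 'v::real_vector \<Rightarrow> real"
  assumes ne: "I \<noteq> {}"
    and bdd: "\<And>v. bdd_below ((\<lambda>i. F i v) ` I)"
    and add: "\<And>i j u v. i \<in> I \<Longrightarrow> j \<in> I \<Longrightarrow> \<exists>k\<in>I. F k (u + v) \<le> F i u + F j v"
    and scale: "\<And>i t v. i \<in> I \<Longrightarrow> t > 0 \<Longrightarrow> \<exists>k\<in>I. F k (t *\<^sub>R v) \<le> t * F i v"
  shows "sublinear (\<lambda>v. INF i\<in>I. F i v)"
proof (rule sublinearI)
  fix u v
  let ?q = "\<lambda>v. INF i\<in>I. F i v"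
  have lower: "?q v \<le> F i v" if "i \<in> I" for i v
    using that bdd by (auto intro: cINF_lower)
  have upper: "?q (u + v) \<le> F i u + F j v" if "i \<in> I" "j \<in> I" for i j
    using add[OF that, of u v] lower by (meson order_trans)
  have "?q (u + v) - F i u \<le> ?q v" if "i \<in> I" for i
    using upper[OF that] by (intro cINF_greatest[OF ne]) (simp add: diff_le_eq add.commute[of _ "F i u"])
  then have "?q (u + v) - ?q v \<le> ?q u"
    by (intro cINF_greatest[OF ne]) (simp add: diff_le_eq add.commute[of _ "?q v"])
  then show "?q (u + v) \<le> ?q u + ?q v" by simp
next
  fix t :: real and v
  let ?q = "\<lambda>v. INF i\<in>I. F i v"
  assume t: "t > 0"
  have lower: "?q v \<le> F i v" if "i \<in> I" for i v
    using that bdd by (auto intro: cINF_lower)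
  have "?q (t *\<^sub>R v) \<le> t * F i v" if "i \<in> I" for i
    using scale[OF that t, of v] lower by (meson order_trans)
  then have "?q (t *\<^sub>R v) / t \<le> ?q v"
    using ne t by (intro cINF_greatest) (auto simp: field_simps)
  then show "?q (t *\<^sub>R v) \<le> t * ?q v"
    using t by (simp add: field_simps)
qed

text \<open>
  The functional \<open>q v = inf {p (v + t x) - t p x | t \<ge> 0}\<close> is the way to make \<open>p\<close> smaller at \<open>- x\<close>,
  down to \<open>- p x\<close>. It shows that a minimal sublinear functional is odd, hence linear, and it also
  prescribes the value at \<open>x\<close> of the linear functional obtained in the end.
\<close>

lemma sublinear_lower_in_direction:
  fixes p :: "'v::real_vector \<Rightarrow> real"
  assumes p: "sublinear p"
  obtains q where "sublinear q" "\<And>v. q v \<le> p v" "q (- x) = - p x"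
proof
  define F where "F t v = p (v + t *\<^sub>R x) - t * p x" for t v
  define q where "q v = (INF t\<in>{0..}. F t v)" for v
  have lb: "- p (- v) \<le> F t v" if "t \<ge> 0" for t v
    using sublinear_add[OF p, of "v + t *\<^sub>R x" "- v"] sublinear_scale[OF p that, of x]
    by (simp add: F_def)
  then have bdd: "bdd_below ((\<lambda>t. F t v) ` {0..})" for v
    by (auto intro!: bdd_belowI)
  show "sublinear q"
    unfolding q_def
  proof (rule sublinear_INF)
    fix s t :: real and u v :: 'v
    assume st: "s \<in> {0..}" "t \<in> {0..}"
    have "F (s + t) (u + v) \<le> F s u + F t v"
      using sublinear_add[OF p, of "u + s *\<^sub>R x" "v + t *\<^sub>R x"]
      by (simp add: F_def algebra_simps)
    with st show "\<exists>k\<in>{0..}. F k (u + v) \<le> F s u + F t v"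
      by (intro bexI[of _ "s + t"]) auto
  next
    fix s t :: real and v :: 'v
    assume st: "s \<in> {0..}" "t > 0"
    have "F (t * s) (t *\<^sub>R v) \<le> t * F s v"
      using sublinear_scale[OF p, of t "v + s *\<^sub>R x"] st
      by (simp add: F_def algebra_simps)
    with st show "\<exists>k\<in>{0..}. F k (t *\<^sub>R v) \<le> t * F s v"
      by (intro bexI[of _ "t * s"]) auto
  qed (use bdd in auto)
  have lower: "q v \<le> F t v" if "t \<ge> 0" for t v
    unfolding q_def using bdd that by (intro cINF_lower) auto
  show "q v \<le> p v" for v
    using lower[of 0 v] by (simp add: F_def)
  have "q (- x) \<le> - p x"
    using lower[of 1 "- x"] sublinear_zero[OF p] by (simp add: F_def)
  moreover have "- p x \<le> q (- x)"
    unfolding q_def using lb[of _ "- x"] by (intro cINF_greatest) auto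
  ultimately show "q (- x) = - p x" by simp
qed

lemma sublinear_odd_imp_linear:
  fixes p :: "'v::real_vector \<Rightarrow> real"
  assumes p: "sublinear p" and odd: "\<And>v. p (- v) = - p v"
  shows "linear p"
proof (rule linearI)
  fix u v
  show "p (u + v) = p u + p v"
    using sublinear_add[OF p, of u v] sublinear_add[OF p, of "- u" "- v"] odd[of u] odd[of v]
      odd[of "u + v"]
    by simp
next
  fix t :: real and v
  show "p (t *\<^sub>R v) = t *\<^sub>R p v"
    using sublinear_scale[OF p, of t v] sublinear_scale[OF p, of "- t" v] odd[of "t *\<^sub>R v"]
    by (cases "t \<ge> 0") auto
qed

text \<open>
  By Zorn's lemma there is a minimal sublinear functional below \<open>p\<close>; by the preceding lemmas it is linear.
  The infimum of a chain stays finite because every sublinear \<open>q \<le> p\<close> satisfies \<open>- p (- v) \<le> q v\<close>.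
\<close>

lemma linear_below_sublinear:
  fixes p :: "'v::real_vector \<Rightarrow> real"
  assumes p: "sublinear p"
  obtains f where "linear f" "\<And>v. f v \<le> p v"
proof -
  define A where "A = {q. sublinear q \<and> (\<forall>v. q v \<le> p v)}"
  define P where "P = (\<lambda>q r :: 'v \<Rightarrow> real. \<forall>v. r v \<le> q v)"
  have po: "partial_order_on A (relation_of P A)"
    by (rule partial_order_on_relation_ofI) (auto simp: P_def fun_eq_iff intro: order_trans antisym)
  have "\<exists>u\<in>A. \<forall>q\<in>C. P q u" if C: "C \<in> Chains (relation_of P A)" for C
  proof (cases "C = {}")
    case True
    with p show ?thesis by (auto simp: A_def)
  next
    case False
    have CA: "sublinear q" "q v \<le> p v" if "q \<in> C" for q v
      using C that by (auto simp: Chains_def relation_of_def A_def)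
    have chain: "P q r \<or> P r q" if "q \<in> C" "r \<in> C" for q r
      using C that by (auto simp: Chains_def relation_of_def)
    have lb: "- p (- v) \<le> q v" if "q \<in> C" for q v
      using sublinear_minus[OF CA(1)[OF that], of v] CA(2)[OF that, of "- v"] by simp
    have bdd: "bdd_below ((\<lambda>q. q v) ` C)" for v
      using lb by (intro bdd_belowI[of _ "- p (- v)"]) auto
    define u where "u v = (INF q\<in>C. q v)" for v
    have lower: "u v \<le> q v" if "q \<in> C" for q v
      unfolding u_def using bdd that by (intro cINF_lower) auto
    have "sublinear u"
      unfolding u_def
    proof (rule sublinear_INF)
      fix q r u v
      assume qr: "q \<in> C" "r \<in> C"
      \<comment> \<open>The smaller of the two functionals serves both arguments.\<close>
      from chain[OF qr] show "\<exists>k\<in>C. k (u + v) \<le> q u + r v"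
      proof
        assume "P q r"
        with qr sublinear_add[OF CA(1), of r u v] show ?thesis
          by (intro bexI[of _ r]) (auto simp: P_def dest!: spec[of _ u])
      next
        assume "P r q"
        with qr sublinear_add[OF CA(1), of q u v] show ?thesis
          by (intro bexI[of _ q]) (auto simp: P_def dest!: spec[of _ v])
      qed
    next
      fix q v and t :: real
      assume "q \<in> C" "t > 0"
      with sublinear_scale[OF CA(1), of q t v] show "\<exists>k\<in>C. k (t *\<^sub>R v) \<le> t * q v"
        by (intro bexI[of _ q]) auto
    qed (use False bdd in auto)
    moreover have "u v \<le> p v" for v
      using False lower CA(2) by (meson ex_in_conv order_trans)
    ultimately show ?thesis
      using lower by (auto simp: A_def P_def)
  qed
  from predicate_Zorn[OF po this] obtain m
    where m: "m \<in> A" and min: "\<And>q. q \<in> A \<Longrightarrow> P m q \<Longrightarrow> q = m" by blast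
  have sub: "sublinear m" using m by (simp add: A_def)
  have "m (- x) = - m x" for x
  proof -
    obtain q where q: "sublinear q" "\<And>v. q v \<le> m v" "q (- x) = - m x"
      using sublinear_lower_in_direction[OF sub] by blast
    then have "q \<in> A" "P m q"
      using m by (auto simp: A_def P_def intro: order_trans)
    with min q(3) show ?thesis by metis
  qed
  with sub have "linear m" by (rule sublinear_odd_imp_linear)
  with m that show ?thesis by (auto simp: A_def)
qed

text \<open>
  Start from the functional \<open>q \<le> p\<close> with \<open>q (- x) = - p x\<close>: every linear \<open>f \<le> q\<close> satisfies
  \<open>f x = - f (- x) \<ge> p x\<close>.
\<close>

theorem Hahn_Banach_sublinear:
  fixes p :: "'v::real_vector \<Rightarrow> real"
  assumes p: "sublinear p"
  obtains f where "linear f" "\<And>v. f v \<le> p v" "f x = p x"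
proof -
  obtain q where q: "sublinear q" "\<And>v. q v \<le> p v" "q (- x) = - p x"
    using sublinear_lower_in_direction[OF p] by blast
  obtain f where f: "linear f" "\<And>v. f v \<le> q v"
    using linear_below_sublinear[OF q(1)] by blast
  have "f x = p x"
    using f(2)[of "- x"] f(2)[of x] q(2)[of x] q(3) linear_neg[OF f(1), of x] by simp
  moreover have "f v \<le> p v" for v
    using f(2) q(2) order_trans by blast
  ultimately show ?thesis using that f(1) by blast
qed

lemma sublinear_infdist_subspace:
  fixes J :: "'v::real_normed_vector set"
  assumes J: "subspace J"
  shows "sublinear (\<lambda>v. infdist v J)"
proof -
  have ne: "J \<noteq> {}" using subspace_0[OF J] by blast
  have "sublinear (\<lambda>v. INF j\<in>J. dist v j)"
  proof (rule sublinear_INF)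
    show "bdd_below (dist v ` J)" for v
      by (auto intro!: bdd_belowI)
  next
    fix i j u v
    assume "i \<in> J" "j \<in> J"
    then show "\<exists>k\<in>J. dist (u + v) k \<le> dist u i + dist v j"
      by (intro bexI[of _ "i + j"] dist_triangle_add subspace_add[OF J])
  next
    fix i v and t :: real
    assume "i \<in> J" "t > 0"
    then show "\<exists>k\<in>J. dist (t *\<^sub>R v) k \<le> t * dist v i"
      by (intro bexI[of _ "t *\<^sub>R i"] subspace_scale[OF J])
        (auto simp: dist_norm simp flip: scaleR_diff_right)
  qed (fact ne)
  then show ?thesis
    using ne by (simp add: infdist_notempty)
qed

text \<open>
  The distance to \<open>J\<close> is sublinear, vanishes on \<open>J\<close>, is positive at \<open>x\<close> and is bounded by the norm; a
  linear functional below it that agrees with it at \<open>x\<close> inherits all of this.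
\<close>

lemma separate_point_closed_subspace_real:
  fixes J :: "'v::real_normed_vector set"
  assumes J: "subspace J" "closed J" and x: "x \<notin> J"
  obtains f where "bounded_linear f" "\<And>j. j \<in> J \<Longrightarrow> f j = 0" "f x > (0::real)"
proof -
  have ne: "J \<noteq> {}" using subspace_0[OF J(1)] by blast
  obtain f where f: "linear f" "\<And>v. f v \<le> infdist v J" "f x = infdist x J"
    using Hahn_Banach_sublinear[OF sublinear_infdist_subspace[OF J(1)]] by blast
  have minus: "f (- v) = - f v" for v by (rule linear_neg[OF f(1)])
  have "infdist v J \<le> norm v" for v
    using infdist_le[OF subspace_0[OF J(1)], of v] by simp
  then have bound: "\<bar>f v\<bar> \<le> norm v" for v
    using f(2)[of v] f(2)[of "- v"] minus[of v] by (smt (verit) norm_minus_cancel)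
  have "bounded_linear f"
    using f(1) bound by (intro bounded_linear_intro[of _ 1]) (auto simp: linear_iff)
  moreover have "f j = 0" if "j \<in> J" for j
    using f(2)[of j] f(2)[of "- j"] minus[of j] that subspace_neg[OF J(1) that] by simp
  moreover have "f x > 0"
    using infdist_pos_not_in_closed[OF J(2) ne x] f(3) by simp
  ultimately show ?thesis using that by blast
qed

section \<open>Real and complex scalars\<close>

text \<open>
  The properties of real part, imaginary part and imaginary unit that the proof uses. The real
  numbers are covered by \<open>im = 0\<close> and \<open>imag_unit = 0\<close>.
\<close>

locale real_or_complex =
  fixes re im :: "'k::{real_normed_field, banach} \<Rightarrow> real" and imag_unit :: 'k
  assumes bounded_linear_re: "bounded_linear re" and bounded_linear_im: "bounded_linear im"
    and decompose: "z = of_real (re z) + imag_unit * of_real (im z)"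
    and mult_conj: "z * (of_real (re z) - imag_unit * of_real (im z)) = of_real ((norm z)\<^sup>2)"
    and imag_unit: "imag_unit = 0 \<or> imag_unit * imag_unit = - 1"
begin

definition conjugate :: "'k \<Rightarrow> 'k" where
  "conjugate z = of_real (re z) - imag_unit * of_real (im z)"

lemma mult_conjugate: "z * conjugate z = of_real ((norm z)\<^sup>2)"
  unfolding conjugate_def by (rule mult_conj)

lemma norm_conjugate: "norm (conjugate z) = norm z"
proof (cases "z = 0")
  case True
  then show ?thesis
    by (simp add: conjugate_def linear_0[OF bounded_linear.linear] bounded_linear_re bounded_linear_im)
next
  case False
  have "norm z * norm (conjugate z) = norm z * norm z"
    using mult_conjugate[of z] by (metis norm_mult norm_of_real abs_norm_cancel abs_power2 power2_eq_square)
  with False show ?thesis by simp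
qed

lemma bounded_linear_conjugate: "bounded_linear conjugate"
  unfolding conjugate_def
  by (intro bounded_linear_sub bounded_linear_const_mult
      bounded_linear_compose[OF bounded_linear_of_real] bounded_linear_re bounded_linear_im)

lemma unimodular_rotation: "\<exists>a. norm a = 1 \<and> a * z = of_real (norm z)" for z :: 'k
proof (cases "z = 0")
  case True
  then show ?thesis by (intro exI[of _ 1]) simp
next
  case False
  then show ?thesis
    using mult_conjugate[of z] norm_conjugate[of z]
    by (intro exI[of _ "conjugate z / of_real (norm z)"])
      (auto simp: norm_divide field_simps power2_eq_square)
qed

text \<open>
  A real functional \<open>f\<close> is turned into the scalar-linear functional \<open>v \<mapsto> f v - \<i> f (\<i> v)\<close>, which
  still vanishes on the \<open>\<i>\<close>-invariant set \<open>J\<close>. For real scalars, where \<open>imag_unit = 0\<close>, the same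
  formula returns \<open>f\<close>.
\<close>

lemma separate_point_closed_subspace:
  fixes s :: "'k \<Rightarrow> 'x::real_normed_vector \<Rightarrow> 'x"
  assumes s: "normed_space_over s" and J: "module.subspace s J" "closed J" and x: "x \<notin> J"
  obtains \<phi> where "\<phi> \<in> annihilator s J" "blinfun_apply \<phi> x \<noteq> 0"
proof -
  interpret normed_space_over s by fact
  have sJ: "s a j \<in> J" if "j \<in> J" for a j
    using J(1) that by (rule subspace_scale)
  have "Real_Vector_Spaces.subspace J"
    using subspace_0[OF J(1)] subspace_add[OF J(1)] sJ[of _ "of_real _"]
    by (auto simp: Real_Vector_Spaces.subspace_def scale_of_real)
  then obtain f where f: "bounded_linear f" "\<And>j. j \<in> J \<Longrightarrow> f j = 0" "f x > (0::real)"
    using separate_point_closed_subspace_real[OF _ J(2) x] by blast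
  interpret f: bounded_linear f by fact
  have "bounded_linear (s imag_unit)"
    by (rule bounded_linear_intro[of _ "norm imag_unit"])
      (simp_all add: scale_right_distrib norm_scale mult.commute flip: scale_of_real)
  then interpret i: bounded_linear "s imag_unit" .
  define g where "g v = of_real (f v) - imag_unit * of_real (f (s imag_unit v))" for v
  have bl: "bounded_linear g"
    unfolding g_def
    by (intro bounded_linear_sub bounded_linear_const_mult
        bounded_linear_compose[OF bounded_linear_of_real] f.bounded_linear_axioms
        bounded_linear_compose[OF f.bounded_linear_axioms] i.bounded_linear_axioms)
  then interpret g: bounded_linear g .
  have gi: "g (s imag_unit v) = imag_unit * g v" for v
    using imag_unit
  proof
    assume ii: "imag_unit * imag_unit = - 1"
    then have "s imag_unit (s imag_unit v) = - v" by simp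
    moreover have "imag_unit * (imag_unit * y) = - y" for y
      using ii by (metis mult.assoc mult_minus1)
    ultimately show ?thesis by (simp add: g_def f.neg right_diff_distrib)
  qed (simp add: g_def f.zero)
  have g_scale: "g (s a v) = a * g v" for a v
  proof -
    have "s a v = s (of_real (re a) + of_real (im a) * imag_unit) v"
      using arg_cong[OF decompose[of a], of "\<lambda>b. s b v"] by (simp only: mult.commute)
    also have "\<dots> = re a *\<^sub>R v + im a *\<^sub>R s imag_unit v"
      by (simp add: scale_left_distrib scale_of_real flip: scale_scale)
    finally have "g (s a v) = of_real (re a) * g v + of_real (im a) * (imag_unit * g v)"
      by (simp only: g.add g.scaleR gi) (simp add: scaleR_conv_of_real)
    also have "\<dots> = (of_real (re a) + imag_unit * of_real (im a)) * g v"
      by (simp add: algebra_simps)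
    finally show ?thesis by (simp flip: decompose)
  qed
  have "g x \<noteq> 0"
    using imag_unit
  proof
    assume ii: "imag_unit * imag_unit = - 1"
    \<comment> \<open>Multiplying by the conjugate shows that \<open>a - \<i> b\<close> is nonzero for real \<open>a \<noteq> 0\<close>.\<close>
    let ?a = "f x" and ?b = "f (s imag_unit x)"
    have "g x * (of_real ?a + imag_unit * of_real ?b)
        = of_real (?a * ?a) - (imag_unit * imag_unit) * of_real (?b * ?b)"
      by (simp add: g_def algebra_simps)
    also have "\<dots> = of_real (?a * ?a + ?b * ?b)"
      by (simp add: ii)
    also have "\<dots> \<noteq> 0"
      using f(3) by (simp only: of_real_eq_0_iff) (simp add: sum_squares_eq_zero_iff)
    finally show ?thesis by auto
  qed (use f(3) in \<open>simp add: g_def\<close>)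
  moreover have "Blinfun g \<in> annihilator s J"
    using g_scale f(2) sJ
    by (auto simp: annihilator_def dual_space_def bounded_linear_Blinfun_apply[OF bl] g_def)
  ultimately show ?thesis
    using that[of "Blinfun g"] by (simp add: bounded_linear_Blinfun_apply[OF bl])
qed

end

section \<open>M-ideals are closed ideals\<close>

lemma apply_Bcontfun_bounded_linear:
  fixes f :: "'a::topological_space \<Rightarrow>\<^sub>C 'b::real_normed_vector"
  assumes "bounded_linear L"
  shows "apply_bcontfun (Bcontfun (\<lambda>x. L (f x))) = (\<lambda>x. L (f x))"
proof -
  have "bounded (L ` range f)"
    by (intro bounded_linear_image[OF _ assms] bounded_apply_bcontfun)
  then show ?thesis
    by (auto simp: bcontfun_def image_image
        intro!: Bcontfun_inverse bounded_linear.continuous_on[OF assms] continuous_on_apply_bcontfun)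
qed

definition bcontfun_mult ::
    "('a::topological_space \<Rightarrow>\<^sub>C 'k::real_normed_field) \<Rightarrow> ('a \<Rightarrow>\<^sub>C 'k) \<Rightarrow> ('a \<Rightarrow>\<^sub>C 'k)" where
  "bcontfun_mult h f = Bcontfun (\<lambda>x. h x * f x)"

lemma apply_bcontfun_mult [simp]: "bcontfun_mult h f x = h x * f x"
proof -
  have "norm (h x * f x) \<le> norm h * norm f" for x
    by (simp add: norm_mult mult_mono norm_bounded)
  then have "bounded (range (\<lambda>x. h x * f x))"
    by (auto simp: bounded_iff)
  then have "(\<lambda>x. h x * f x) \<in> bcontfun"
    by (auto simp: bcontfun_def intro!: continuous_intros)
  then show ?thesis
    by (simp add: bcontfun_mult_def Bcontfun_inverse)
qed

lemma bounded_linear_bcontfun_mult: "bounded_linear (bcontfun_mult h)"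
proof (rule bounded_linear_intro)
  show "norm (bcontfun_mult h f) \<le> norm f * norm h" for f
    by (rule norm_bound)
      (simp add: norm_mult mult_mono norm_bounded mult.commute[of "norm f"])
qed (auto intro!: bcontfun_eqI simp: algebra_simps)

text \<open>
  The functional \<open>h \<phi>\<close>, in terms of measures the one with density \<open>h\<close> with respect to \<open>\<phi>\<close>.
\<close>

definition mult_functional ::
    "('a::topological_space \<Rightarrow>\<^sub>C 'k::real_normed_field) \<Rightarrow> (('a \<Rightarrow>\<^sub>C 'k) \<Rightarrow>\<^sub>L 'k) \<Rightarrow> (('a \<Rightarrow>\<^sub>C 'k) \<Rightarrow>\<^sub>L 'k)"
  where "mult_functional h \<phi> = \<phi> o\<^sub>L Blinfun (bcontfun_mult h)"

lemma mult_functional_apply [simp]: "mult_functional h \<phi> f = \<phi> (bcontfun_mult h f)"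
  by (simp add: mult_functional_def bounded_linear_Blinfun_apply[OF bounded_linear_bcontfun_mult])

lemma mult_functional_in_dual_space:
  assumes "\<phi> \<in> dual_space bcontfun_scale"
  shows "mult_functional h \<phi> \<in> dual_space bcontfun_scale"
proof -
  have "bcontfun_mult h (bcontfun_scale a f) = bcontfun_scale a (bcontfun_mult h f)" for a f
    by (intro bcontfun_eqI) (simp add: apply_bcontfun_scale)
  with assms show ?thesis by (simp add: dual_space_def)
qed

lemma norm_blinfun_le_unit_ball:
  fixes \<phi> :: "'x::real_normed_vector \<Rightarrow>\<^sub>L 'y::real_normed_vector"
  assumes "\<And>x. norm x \<le> 1 \<Longrightarrow> norm (\<phi> x) \<le> c"
  shows "norm \<phi> \<le> c"
proof (rule norm_blinfun_bound)
  show "0 \<le> c" using assms[of 0] by simp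
  show "norm (\<phi> x) \<le> c * norm x" for x
    using assms[of "x /\<^sub>R norm x"] by (cases "x = 0") (auto simp: blinfun.scaleR_right field_simps)
qed

context real_or_complex
begin

text \<open>
  Test \<open>h \<phi>\<close> with \<open>f\<close> and \<open>k \<phi>\<close> with \<open>g\<close>, where \<open>f\<close> and \<open>g\<close> belong to the unit ball. After rotating \<open>f\<close>
  and \<open>g\<close> by unimodular scalars, the sum of the two absolute values is \<open>\<phi> (h f + k g)\<close>, and
  \<open>h f + k g\<close> again belongs to the unit ball.
\<close>

lemma norm_mult_functional_add_le:
  fixes \<phi> :: "('a::topological_space \<Rightarrow>\<^sub>C 'k) \<Rightarrow>\<^sub>L 'k" and h k :: "'a \<Rightarrow>\<^sub>C 'k"
  assumes \<phi>: "\<phi> \<in> dual_space bcontfun_scale"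
    and hk: "\<And>x. norm (h x) + norm (k x) \<le> 1"
  shows "norm (mult_functional h \<phi>) + norm (mult_functional k \<phi>) \<le> norm \<phi>"
proof -
  have key: "norm (mult_functional h \<phi> f) + norm (mult_functional k \<phi> g) \<le> norm \<phi>"
    if fg: "norm f \<le> 1" "norm g \<le> 1" for f g
  proof -
    obtain a where a: "norm a = 1" "a * mult_functional h \<phi> f = of_real (norm (mult_functional h \<phi> f))"
      using unimodular_rotation by blast
    obtain b where b: "norm b = 1" "b * mult_functional k \<phi> g = of_real (norm (mult_functional k \<phi> g))"
      using unimodular_rotation by blast
    define e where "e = bcontfun_scale a (bcontfun_mult h f) + bcontfun_scale b (bcontfun_mult k g)"
    have "norm (e x) \<le> 1" for x
    proof -
      have "norm (e x) \<le> norm (h x) * norm (f x) + norm (k x) * norm (g x)"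
        using norm_triangle_ineq[of "a * (h x * f x)" "b * (k x * g x)"] a(1) b(1)
        by (simp add: e_def apply_bcontfun_scale norm_mult)
      also have "\<dots> \<le> norm (h x) * 1 + norm (k x) * 1"
        using fg norm_bounded[of f x] norm_bounded[of g x]
        by (intro add_mono mult_left_mono) auto
      finally show ?thesis using hk[of x] by simp
    qed
    then have "norm e \<le> 1" by (intro norm_bound)
    have "\<phi> e = a * mult_functional h \<phi> f + b * mult_functional k \<phi> g"
      using \<phi> by (simp add: e_def blinfun.add_right dual_space_def)
    also have "\<dots> = of_real (norm (mult_functional h \<phi> f) + norm (mult_functional k \<phi> g))"
      by (simp only: a(2) b(2) of_real_add)
    finally have "norm (\<phi> e) = norm (mult_functional h \<phi> f) + norm (mult_functional k \<phi> g)"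
      by (simp only: norm_of_real) simp
    moreover have "norm (\<phi> e) \<le> norm \<phi> * 1"
      using norm_blinfun[of \<phi> e] \<open>norm e \<le> 1\<close> by (meson mult_left_mono norm_ge_zero order_trans)
    ultimately show ?thesis by simp
  qed
  have "norm (mult_functional h \<phi>) \<le> norm \<phi> - norm (mult_functional k \<phi> g)" if "norm g \<le> 1" for g
    using key[OF _ that] by (intro norm_blinfun_le_unit_ball) (simp add: le_diff_eq)
  then have "norm (mult_functional k \<phi>) \<le> norm \<phi> - norm (mult_functional h \<phi>)"
    by (intro norm_blinfun_le_unit_ball) (simp add: le_diff_eq add.commute)
  then show ?thesis by simp
qed

text \<open>
  The heart of the proof: splitting \<open>\<phi> = h \<phi> + (1 - h) \<phi>\<close> loses no norm, and neither does splitting each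
  part by the L-projection. As \<open>\<phi>\<close> is already in the range of the projection, there is no norm left for
  the complementary parts. The condition on \<open>h\<close> says that its values are in \<open>[0, 1]\<close>.
\<close>

lemma mult_functional_in_annihilator:
  fixes J :: "('a::topological_space \<Rightarrow>\<^sub>C 'k) set" and h :: "'a \<Rightarrow>\<^sub>C 'k"
  assumes J: "M_ideal bcontfun_scale J" and \<phi>: "\<phi> \<in> annihilator bcontfun_scale J"
    and h: "\<And>x. norm (h x) + norm (1 - h x) \<le> 1"
  shows "mult_functional h \<phi> \<in> annihilator bcontfun_scale J"
proof -
  let ?V = "dual_space bcontfun_scale :: (('a \<Rightarrow>\<^sub>C 'k) \<Rightarrow>\<^sub>L 'k) set"
  let ?W = "annihilator bcontfun_scale J"
  obtain P where add: "\<And>u v. u \<in> ?V \<Longrightarrow> v \<in> ?V \<Longrightarrow> P (u + v) = P u + P v"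
    and img: "P ` ?V = ?W" and idem: "\<And>v. v \<in> ?V \<Longrightarrow> P (P v) = P v"
    and norm: "\<And>v. v \<in> ?V \<Longrightarrow> norm v = norm (P v) + norm (v - P v)"
    using J unfolding M_ideal_def L_summand_def by metis
  define \<mu> where "\<mu> = mult_functional h \<phi>"
  define \<nu> where "\<nu> = mult_functional (const_bcontfun 1 - h) \<phi>"
  have \<phi>V: "\<phi> \<in> ?V" using \<phi> by (simp add: annihilator_def)
  then have V: "\<mu> \<in> ?V" "\<nu> \<in> ?V"
    by (simp_all add: \<mu>_def \<nu>_def mult_functional_in_dual_space)
  have sum: "\<mu> + \<nu> = \<phi>"
  proof (rule blinfun_eqI)
    fix f
    have "bcontfun_mult h f + bcontfun_mult (const_bcontfun 1 - h) f = f"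
      by (intro bcontfun_eqI) (simp add: const_bcontfun.rep_eq algebra_simps)
    then show "(\<mu> + \<nu>) f = \<phi> f"
      by (simp add: \<mu>_def \<nu>_def blinfun.add_left flip: blinfun.add_right)
  qed
  have "norm \<mu> + norm \<nu> \<le> norm \<phi>"
    unfolding \<mu>_def \<nu>_def using h
    by (intro norm_mult_functional_add_le[OF \<phi>V]) (simp add: const_bcontfun.rep_eq)
  moreover have P\<phi>: "P \<mu> + P \<nu> = \<phi>"
    using add[OF V] sum img idem \<phi> by (metis imageE)
  then have "norm \<phi> \<le> norm (P \<mu>) + norm (P \<nu>)"
    by (metis norm_triangle_ineq)
  ultimately have "norm (\<mu> - P \<mu>) \<le> 0"
    using norm[OF V(1)] norm[OF V(2)] norm_ge_zero[of "\<nu> - P \<nu>"] by linarith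
  then have "\<mu> = P \<mu>" by simp
  then show ?thesis
    using img V(1) unfolding \<mu>_def by blast
qed

text \<open>
  Multipliers with values in \<open>[0, 1]\<close> preserve \<open>J\<close> because functionals separate points from \<open>J\<close>. Affine
  rescaling gives bounded real multipliers, and the decomposition into real and imaginary parts
  gives all others.
\<close>

lemma M_ideal_imp_ideal:
  fixes J :: "('a::topological_space \<Rightarrow>\<^sub>C 'k) set"
  assumes M: "M_ideal bcontfun_scale J" and f: "f \<in> J"
  shows "bcontfun_mult h f \<in> J"
proof -
  interpret X: normed_space_over "bcontfun_scale :: 'k \<Rightarrow> ('a \<Rightarrow>\<^sub>C 'k) \<Rightarrow> _"
    by (rule normed_space_over_bcontfun_scale)
  have J: "X.subspace J" "closed J" using M by (auto simp: M_ideal_def)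
  have unit_interval: "bcontfun_mult h f \<in> J" if "\<And>x. norm (h x) + norm (1 - h x) \<le> 1" for h :: "'a \<Rightarrow>\<^sub>C 'k"
  proof (rule ccontr)
    assume "bcontfun_mult h f \<notin> J"
    then obtain \<phi> where \<phi>: "\<phi> \<in> annihilator bcontfun_scale J" "\<phi> (bcontfun_mult h f) \<noteq> 0"
      using separate_point_closed_subspace[OF X.normed_space_over_axioms J] by blast
    then show False
      using mult_functional_in_annihilator[OF M \<phi>(1) that] f
      by (auto simp: annihilator_def)
  qed
  have real: "bcontfun_mult h f \<in> J" if h: "\<And>x. h x = of_real (r x)" for h :: "'a \<Rightarrow>\<^sub>C 'k" and r
  proof -
    \<comment> \<open>The summand 1 only makes \<open>c\<close> positive; \<open>k\<close> maps the range \<open>[-c, c]\<close> affinely to \<open>[0, 1]\<close>.\<close>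
    define c where "c = norm h + 1"
    have c: "c > 0" by (simp add: c_def add_nonneg_pos)
    define k where "k = (1 / (2 * c)) *\<^sub>R (h + const_bcontfun (of_real c))"
    have k: "k x = of_real ((r x + c) / (2 * c))" for x
      by (simp add: k_def h const_bcontfun.rep_eq scaleR_conv_of_real add_divide_distrib)
    have "norm (k x) + norm (1 - k x) \<le> 1" for x
    proof -
      define t where "t = (r x + c) / (2 * c)"
      have "\<bar>r x\<bar> \<le> c"
        using norm_bounded[of h x] by (simp add: h c_def)
      then have "0 \<le> t" "t \<le> 1"
        using c by (auto simp: t_def field_simps)
      moreover have "k x = of_real t" "1 - k x = of_real (1 - t)"
        by (simp_all add: k t_def)
      ultimately show ?thesis by (simp only: norm_of_real)
    qed
    then have "bcontfun_mult k f \<in> J" by (rule unit_interval)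
    moreover have "bcontfun_mult h f
        = bcontfun_scale (of_real (2 * c)) (bcontfun_mult k f) - bcontfun_scale (of_real c) f"
      using c by (intro bcontfun_eqI) (simp add: apply_bcontfun_scale k h field_simps)
    ultimately show ?thesis
      using f by (simp add: X.subspace_diff[OF J(1)] X.subspace_scale[OF J(1)])
  qed
  define hr where "hr = Bcontfun (\<lambda>x. of_real (re (h x)) :: 'k)"
  define hi where "hi = Bcontfun (\<lambda>x. of_real (im (h x)) :: 'k)"
  have hr: "hr x = of_real (re (h x))" and hi: "hi x = of_real (im (h x))" for x
    unfolding hr_def hi_def
    by (subst apply_Bcontfun_bounded_linear;
        auto intro!: bounded_linear_compose[OF bounded_linear_of_real]
          bounded_linear_re bounded_linear_im)+
  have "h x * f x = hr x * f x + imag_unit * (hi x * f x)" for x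
    using arg_cong[OF decompose[of "h x"], of "\<lambda>z. z * f x"] by (simp add: hr hi algebra_simps)
  then have "bcontfun_mult h f = bcontfun_mult hr f + bcontfun_scale imag_unit (bcontfun_mult hi f)"
    by (intro bcontfun_eqI) (simp add: apply_bcontfun_scale)
  with real[OF hr] real[OF hi] show ?thesis
    by (simp add: X.subspace_add[OF J(1)] X.subspace_scale[OF J(1)])
qed

text \<open>
  Let \<open>f\<close> vanish at the common zeros of \<open>J\<close>. On the compact set \<open>K\<close> where \<open>\<bar>f\<bar> \<ge> \<epsilon>/2\<close>, finitely many \<open>g \<in> J\<close>
  have no common zero, so \<open>G = \<Sum> \<bar>g\<bar>\<^sup>2\<close> belongs to \<open>J\<close> and satisfies \<open>G \<ge> m > 0\<close> on \<open>K\<close>. The element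
  \<open>f G / max(G, m)\<close> of \<open>J\<close> agrees with \<open>f\<close> on \<open>K\<close> and differs from it by at most \<open>\<bar>f\<bar>\<close> elsewhere.
\<close>

lemma closed_ideal_eq_vanishing:
  fixes J :: "('a::topological_space \<Rightarrow>\<^sub>C 'k) set" and f :: "'a \<Rightarrow>\<^sub>C 'k"
  assumes comp: "compact (UNIV :: 'a set)"
    and J: "module.subspace bcontfun_scale J" "closed J"
    and ideal: "\<And>h f. f \<in> J \<Longrightarrow> bcontfun_mult h f \<in> J"
    and f: "\<And>x. (\<And>g. g \<in> J \<Longrightarrow> g x = 0) \<Longrightarrow> f x = 0"
  shows "f \<in> J"
proof -
  interpret X: normed_space_over "bcontfun_scale :: 'k \<Rightarrow> ('a \<Rightarrow>\<^sub>C 'k) \<Rightarrow> _"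
    by (rule normed_space_over_bcontfun_scale)
  have "\<exists>g\<in>J. dist g f < \<epsilon>" if \<epsilon>: "\<epsilon> > 0" for \<epsilon>
  proof -
    define K where "K = {x. \<epsilon> / 2 \<le> norm (f x)}"
    have "closed K"
      unfolding K_def by (intro closed_Collect_le continuous_intros) auto
    then have K: "compact K"
      using compact_Int_closed[OF comp] by simp
    have "\<exists>g\<in>J. g x \<noteq> 0" if "x \<in> K" for x
    proof (rule ccontr)
      assume "\<not> ?thesis"
      then have "f x = 0" by (intro f) auto
      with that \<epsilon> show False by (simp add: K_def)
    qed
    then have cover: "K \<subseteq> (\<Union>g\<in>J. {x. apply_bcontfun g x \<noteq> 0})" by auto
    have op: "open {x. apply_bcontfun g x \<noteq> 0}" for g :: "'a \<Rightarrow>\<^sub>C 'k"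
      by (intro open_Collect_neq continuous_intros) auto
    obtain F where F: "F \<subseteq> J" "finite F" "K \<subseteq> (\<Union>g\<in>F. {x. apply_bcontfun g x \<noteq> 0})"
      by (rule compactE_image[OF K op cover])
    define cj where "cj g = Bcontfun (\<lambda>x. conjugate (apply_bcontfun g x))" for g :: "'a \<Rightarrow>\<^sub>C 'k"
    have cj: "cj g x = conjugate (g x)" for g x
      by (simp add: cj_def apply_Bcontfun_bounded_linear[OF bounded_linear_conjugate])
    define G where "G = (\<Sum>g\<in>F. bcontfun_mult (cj g) g)"
    define r where "r x = (\<Sum>g\<in>F. (norm (apply_bcontfun g x))\<^sup>2)" for x
    have GJ: "G \<in> J"
      unfolding G_def using F(1) ideal by (intro X.subspace_sum[OF J(1)]) auto
    have "apply_bcontfun (sum w F) x = (\<Sum>g\<in>F. w g x)" for w :: "('a \<Rightarrow>\<^sub>C 'k) \<Rightarrow> ('a \<Rightarrow>\<^sub>C 'k)" and x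
      by (induction F rule: infinite_finite_induct) auto
    then have G: "G x = of_real (r x)" for x
      by (simp add: G_def r_def cj mult.commute[of "conjugate _"] mult_conjugate flip: of_real_power)
    have r0: "r x \<ge> 0" for x by (simp add: r_def sum_nonneg)
    have rK: "r x > 0" if "x \<in> K" for x
    proof -
      obtain g where "g \<in> F" "g x \<noteq> 0" using F(3) \<open>x \<in> K\<close> by blast
      then show ?thesis
        unfolding r_def using F(2) by (intro sum_pos2[of _ g]) auto
    qed
    have r_cont: "continuous_on S r" for S
      unfolding r_def by (intro continuous_intros) auto
    obtain m where m: "m > 0" "\<And>x. x \<in> K \<Longrightarrow> m \<le> r x"
    proof (cases "K = {}")
      case True
      then show ?thesis using that[of 1] by simp
    next
      case False
      then obtain x0 where "x0 \<in> K" "\<forall>x\<in>K. r x0 \<le> r x"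
        using continuous_attains_inf[OF K _ r_cont] by blast
      then show ?thesis using that[of "r x0"] rK by blast
    qed
    define h where "h x = f x / of_real (max (r x) m)" for x
    have "continuous_on UNIV h"
      unfolding h_def using m(1) by (intro continuous_intros r_cont) auto
    then obtain H where H: "\<And>x. apply_bcontfun H x = h x"
      using bcontfun_eq_continuous[OF comp, where 'k='k] by (metis (mono_tags, lifting) imageE mem_Collect_eq)
    have "norm ((bcontfun_mult H G - f) x) \<le> \<epsilon> / 2" for x
    proof -
      have eq: "(bcontfun_mult H G - f) x = of_real (r x / max (r x) m - 1) * f x"
        using m(1) by (simp add: H h_def G algebra_simps)
      show ?thesis
      proof (cases "x \<in> K")
        case True
        with m(2)[of x] m(1) have "r x / max (r x) m = 1" by (simp add: max_absorb1)
        with eq \<epsilon> show ?thesis by simp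
      next
        case False
        have "0 \<le> r x / max (r x) m" "r x / max (r x) m \<le> 1"
          using m(1) r0[of x] by (auto simp: divide_simps max_def)
        then have "norm ((bcontfun_mult H G - f) x) \<le> 1 * norm (f x)"
          unfolding eq norm_mult norm_of_real by (intro mult_right_mono) auto
        with False show ?thesis by (simp add: K_def)
      qed
    qed
    then have "norm (bcontfun_mult H G - f) \<le> \<epsilon> / 2" by (rule norm_bound)
    with \<epsilon> ideal[OF GJ, of H] show ?thesis
      by (intro bexI[of _ "bcontfun_mult H G"]) (auto simp: dist_norm)
  qed
  then show ?thesis
    using J(2) by (metis closed_approachable)
qed

end

section \<open>A linear extension operator for continuous functions\<close>

text \<open>
  A compact metrizable topology is described by an explicit metric function here, because the
  points form a type of class \<^class>\<open>topological_space\<close> only.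
\<close>

locale metrized = Metric_space UNIV d for d :: "'a::topological_space \<Rightarrow> 'a \<Rightarrow> real" +
  assumes mtopology_eq: "mtopology = euclidean"
begin

lemma dist_triangle: "d x z \<le> d x y + d y z"
  by (simp add: triangle)

lemma open_metric_ball: "open {y. d x y < r}"
proof -
  have "mball x r = {y. d x y < r}" by auto
  then show ?thesis
    using openin_mball[of x r] by (simp add: mtopology_eq)
qed

lemma open_contains_metric_ball:
  assumes "open U" "x \<in> U"
  obtains r where "r > 0" "\<And>y. d x y < r \<Longrightarrow> y \<in> U"
proof -
  have "openin mtopology U" using assms by (simp add: mtopology_eq)
  then obtain r where "r > 0" "mball x r \<subseteq> U"
    using assms(2) by (auto simp: openin_mtopology)
  moreover have "y \<in> U" if "d x y < r" for y
    using \<open>mball x r \<subseteq> U\<close> that by auto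
  ultimately show ?thesis using that by blast
qed

lemma eventually_metric_ball: "r > 0 \<Longrightarrow> eventually (\<lambda>y. d x y < r) (at x)"
  unfolding eventually_at_topological
  by (rule exI[of _ "{y. d x y < r}"]) (simp add: open_metric_ball)

lemma continuous_on_lipschitz:
  fixes g :: "'a \<Rightarrow> real"
  assumes "\<And>x y. g x \<le> g y + d x y"
  shows "continuous_on S g"
proof -
  have "(g \<longlongrightarrow> g x) (at x)" for x
    unfolding tendsto_iff
  proof (intro allI impI)
    fix e :: real assume "e > 0"
    have "dist (g y) (g x) < e" if "d x y < e" for y
      using assms[of x y] assms[of y x] that commute[of x y] unfolding dist_real_def by linarith
    then show "eventually (\<lambda>y. dist (g y) (g x) < e) (at x)"
      by (rule eventually_mono[OF eventually_metric_ball[OF \<open>e > 0\<close>]])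
  qed
  then have "continuous_on UNIV g" by (simp add: continuous_on_def)
  then show ?thesis by (rule continuous_on_subset) simp
qed

lemma continuous_on_dist_to: "continuous_on S (\<lambda>x. d x a)"
proof (rule continuous_on_lipschitz)
  show "d x a \<le> d y a + d x y" for x y
    using dist_triangle[of x a y] by simp
qed

text \<open>
  Enumerate the union of finite \<open>1/(k+1)\<close>-nets of \<open>D\<close> for all \<open>k\<close>.
\<close>

lemma compact_dense_sequence:
  assumes D: "compact D" "D \<noteq> {}"
  shows "\<exists>p :: nat \<Rightarrow> 'a. range p \<subseteq> D \<and> (\<forall>x\<in>D. \<forall>e>0. \<exists>n. d x (p n) < e)"
proof -
  have "\<exists>F. F \<subseteq> D \<and> finite F \<and> D \<subseteq> (\<Union>x\<in>F. {y. d x y < inverse (Suc k)})" for k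
  proof -
    have "D \<subseteq> (\<Union>x\<in>D. {y. d x y < inverse (Suc k)})" by auto
    then show ?thesis
      by (rule compactE_image[OF D(1) open_metric_ball]) blast
  qed
  then obtain F where F: "\<And>k. F k \<subseteq> D" "\<And>k. finite (F k)"
    "\<And>k. D \<subseteq> (\<Union>x\<in>F k. {y. d x y < inverse (Suc k)})"
    by metis
  define Q where "Q = (\<Union>k. F k)"
  have Q: "countable Q"
    unfolding Q_def by (intro countable_UN) (auto intro: countable_finite F(2))
  have Q': "Q \<noteq> {}"
  proof
    assume "Q = {}"
    then have "F 0 = {}" by (auto simp: Q_def)
    then show False using F(3)[of 0] D(2) by simp
  qed
  have "\<exists>n. d x (from_nat_into Q n) < e" if "x \<in> D" "e > 0" for x e
  proof -
    obtain k where k: "inverse (Suc k) < e"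
      using reals_Archimedean[OF \<open>e > 0\<close>] by blast
    obtain q where "q \<in> F k" "d q x < inverse (Suc k)"
      using F(3)[of k] \<open>x \<in> D\<close> by blast
    with k have "d x q < e"
      using commute[of x q] by linarith
    moreover have "q \<in> Q" using \<open>q \<in> F k\<close> by (auto simp: Q_def)
    ultimately show ?thesis
      using from_nat_into_surj[OF Q] by metis
  qed
  moreover have "range (from_nat_into Q) \<subseteq> D"
    using F(1) range_from_nat_into[OF Q' Q] by (auto simp: Q_def)
  ultimately show ?thesis by (intro exI[of _ "from_nat_into Q"] conjI ballI allI impI)
qed

end

locale dense_in_closed = metrized d for d :: "'a::topological_space \<Rightarrow> 'a \<Rightarrow> real" +
  fixes D :: "'a set" and p :: "nat \<Rightarrow> 'a"
  assumes compact_UNIV: "compact (UNIV :: 'a set)" and closed_D: "closed D"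
    and p_in: "p n \<in> D" and p_dense: "x \<in> D \<Longrightarrow> e > 0 \<Longrightarrow> \<exists>n. d x (p n) < e"
begin

text \<open>
  As \<open>p\<close> is dense in \<open>D\<close>, this is the distance from \<open>x\<close> to \<open>D\<close>.
\<close>

definition \<delta> :: "'a \<Rightarrow> real" where
  "\<delta> x = (INF n. d x (p n))"

lemma delta_le: "\<delta> x \<le> d x (p n)"
  unfolding \<delta>_def by (rule cINF_lower) (auto intro!: bdd_belowI[of _ 0])

lemma delta_lipschitz: "\<delta> x \<le> \<delta> y + d x y"
proof -
  have "\<delta> x - d x y \<le> d y (p n)" for n
    using delta_le[of x n] dist_triangle[of x "p n" y] by linarith
  then have "\<delta> x - d x y \<le> \<delta> y"
    unfolding \<delta>_def[of y] by (intro cINF_greatest) auto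
  then show ?thesis by simp
qed

lemma delta_le_dist:
  assumes "y \<in> D"
  shows "\<delta> x \<le> d x y"
proof (rule field_le_epsilon)
  fix e :: real assume "e > 0"
  then obtain n where "d y (p n) < e" using p_dense[OF assms] by blast
  then show "\<delta> x \<le> d x y + e"
    using delta_le[of x n] dist_triangle[of x "p n" y] by linarith
qed

lemma delta_pos:
  assumes "x \<notin> D"
  shows "\<delta> x > 0"
proof -
  obtain r where r: "r > 0" "\<And>y. d x y < r \<Longrightarrow> y \<in> - D"
    using open_contains_metric_ball[of "- D" x] assms closed_D by auto
  then have "r \<le> d x (p n)" for n
    using p_in[of n] by (meson ComplD not_le)
  then have "r \<le> \<delta> x"
    unfolding \<delta>_def by (intro cINF_greatest) auto
  with r(1) show ?thesis by simp
qed

definition weight :: "nat \<Rightarrow> 'a \<Rightarrow> real" where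
  "weight n x = (1/2) ^ n * max 0 (2 * \<delta> x - d x (p n))"

definition total_weight :: "'a \<Rightarrow> real" where
  "total_weight x = (\<Sum>n. weight n x)"

definition wsum :: "('a \<Rightarrow> 'b::banach) \<Rightarrow> 'a \<Rightarrow> 'b" where
  "wsum f x = (\<Sum>n. weight n x *\<^sub>R f (p n))"

text \<open>
  Off \<open>D\<close>, the weighted mean of the values of \<open>f\<close> at the points \<open>p n\<close> with \<open>d x (p n) < 2 * \<delta> x\<close>.
\<close>

definition extend :: "('a \<Rightarrow> 'b::banach) \<Rightarrow> 'a \<Rightarrow> 'b" where
  "extend f x = (if x \<in> D then f x else wsum f x /\<^sub>R total_weight x)"

lemma weight_nonneg: "0 \<le> weight n x"
  unfolding weight_def by (intro mult_nonneg_nonneg) auto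

text \<open>
  A geometric bound uniform in \<open>x\<close>, for the Weierstrass M-test. It holds because
  \<open>2 * \<delta> x - d x (p n) \<le> \<delta> x\<close>, and \<open>\<delta>\<close> is bounded on the compact space.
\<close>

lemma weight_bound:
  "\<exists>B>0. \<forall>n x. weight n x \<le> B * (1/2) ^ n"
proof -
  obtain x0 where "\<And>x. d x (p 0) \<le> d x0 (p 0)"
    using continuous_attains_sup[OF compact_UNIV _ continuous_on_dist_to[of UNIV "p 0"]] by auto
  then have "max 0 (2 * \<delta> x - d x (p n)) \<le> d x0 (p 0) + 1" for n x
    using delta_le[of x n] delta_le[of x 0] nonneg[of x0 "p 0"] by (smt (verit))
  then have "max 0 (2 * \<delta> x - d x (p n)) * (1/2) ^ n \<le> (d x0 (p 0) + 1) * (1/2) ^ n" for n x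
    by (intro mult_right_mono) simp_all
  then have "weight n x \<le> (d x0 (p 0) + 1) * (1/2) ^ n" for n x
    by (simp only: weight_def mult.commute[of "(1/2) ^ n"])
  moreover have "d x0 (p 0) + 1 > 0"
    using nonneg[of x0 "p 0"] by linarith
  ultimately show ?thesis by (intro exI[of _ "d x0 (p 0) + 1"]) simp
qed

lemma continuous_on_weight: "continuous_on S (weight n)"
proof -
  have \<delta>: "continuous_on S \<delta>"
    by (rule continuous_on_lipschitz) (rule delta_lipschitz)
  have "continuous_on S (\<lambda>x. 2 * \<delta> x - d x (p n))"
    by (rule continuous_on_diff[OF continuous_on_mult_left[OF \<delta>] continuous_on_dist_to])
  then have "continuous_on S (\<lambda>x. max 0 (2 * \<delta> x - d x (p n)))"
    by (rule continuous_on_max[OF continuous_on_const])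
  then show ?thesis
    unfolding weight_def by (rule continuous_on_mult_left)
qed

lemma summable_weight: "summable (\<lambda>n. weight n x)"
proof -
  obtain B where B: "\<And>n x. weight n x \<le> B * (1/2) ^ n" "B > 0"
    using weight_bound by auto
  have "summable (\<lambda>n. B * (1/2) ^ n)"
    by (intro summable_mult summable_geometric) simp
  then show ?thesis
    by (rule summable_comparison_test'[of _ 0]) (simp add: B weight_nonneg)
qed

lemma wsum_uniform:
  fixes f :: "'a \<Rightarrow> 'b::banach"
  assumes C: "\<And>n. norm (f (p n)) \<le> C"
  shows "continuous_on UNIV (wsum f)" "summable (\<lambda>n. norm (weight n x *\<^sub>R f (p n)))"
proof -
  obtain B where B: "\<And>n x. weight n x \<le> B * (1/2) ^ n" "B > 0"
    using weight_bound by auto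
  have bound: "norm (weight n x *\<^sub>R f (p n)) \<le> (B * C) * (1/2) ^ n" for n x
  proof -
    have "weight n x * norm (f (p n)) \<le> (B * (1/2) ^ n) * C"
      using B weight_nonneg C by (intro mult_mono) auto
    also have "\<dots> = (B * C) * (1/2) ^ n" by (simp only: mult_ac)
    finally show ?thesis
      by (simp only: norm_scaleR abs_of_nonneg[OF weight_nonneg])
  qed
  have sum: "summable (\<lambda>n. (B * C) * (1/2) ^ n)"
    by (intro summable_mult summable_geometric) auto
  show "summable (\<lambda>n. norm (weight n x *\<^sub>R f (p n)))"
    by (rule summable_comparison_test'[OF sum, of 0]) (simp only: real_norm_def abs_norm_cancel bound)
  have lim: "uniform_limit UNIV (\<lambda>n x. \<Sum>i<n. weight i x *\<^sub>R f (p i)) (wsum f) sequentially"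
    unfolding wsum_def by (rule Weierstrass_m_test[OF bound sum])
  have cont: "continuous_on UNIV (\<lambda>x. \<Sum>i<n. weight i x *\<^sub>R f (p i))" for n
    by (rule continuous_on_sum)
      (rule continuous_on_scaleR[OF continuous_on_weight continuous_on_const])
  show "continuous_on UNIV (wsum f)"
    by (rule uniform_limit_theorem[OF _ lim]) (simp_all add: cont always_eventually)
qed

text \<open>
  Off \<open>D\<close> the distance is positive, so by density some \<open>p n\<close> is closer to \<open>x\<close> than twice the distance.
\<close>

lemma total_pos:
  assumes "x \<notin> D"
  shows "total_weight x > 0"
proof -
  have "\<delta> x < 2 * \<delta> x" using delta_pos[OF assms] by simp
  then obtain n where n: "d x (p n) < 2 * \<delta> x"
    unfolding \<delta>_def[of x] by (subst (asm) cINF_less_iff) (auto intro!: bdd_belowI[of _ 0])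
  then have "weight n x > 0" by (simp add: weight_def)
  then show ?thesis
    unfolding total_weight_def by (intro suminf_pos2[OF summable_weight weight_nonneg])
qed

lemma continuous_on_total: "continuous_on UNIV total_weight"
proof -
  have "wsum (\<lambda>_. 1 :: real) = total_weight"
    by (rule ext) (simp add: wsum_def total_weight_def)
  moreover have "continuous_on UNIV (wsum (\<lambda>_. 1 :: real))"
    by (rule wsum_uniform(1)[of _ 1]) simp
  ultimately show ?thesis by simp
qed

text \<open>
  A mean of values close to \<open>c\<close> is close to \<open>c\<close>. With \<open>c = 0\<close> this bounds the norm of the extension, and
  with \<open>c = f x\<^sub>0\<close> it yields continuity at points \<open>x\<^sub>0\<close> of \<open>D\<close>.
\<close>

lemma extend_close:
  fixes f :: "'a \<Rightarrow> 'b::banach"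
  assumes x: "x \<notin> D" and C: "\<And>n. norm (f (p n)) \<le> C"
    and close: "\<And>n. d x (p n) < 2 * \<delta> x \<Longrightarrow> norm (f (p n) - c) \<le> e"
  shows "norm (extend f x - c) \<le> e"
proof -
  note sums = summable_norm_cancel[OF wsum_uniform(2)[of f C x, OF C]]
  have C': "norm (f (p n) - c) \<le> C + norm c" for n
    using norm_triangle_ineq4[of "f (p n)" c] C[of n] by linarith
  have "wsum f x - total_weight x *\<^sub>R c = (\<Sum>n. weight n x *\<^sub>R f (p n) - weight n x *\<^sub>R c)"
    unfolding wsum_def total_weight_def
    by (simp add: suminf_diff sums summable_scaleR_left suminf_scaleR_left summable_weight)
  also have "norm \<dots> \<le> (\<Sum>n. norm (weight n x *\<^sub>R (f (p n) - c)))"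
    using summable_norm[OF wsum_uniform(2)[of "\<lambda>y. f y - c" "C + norm c" x, OF C']]
    by (simp add: scaleR_diff_right)
  also have "\<dots> \<le> (\<Sum>n. weight n x * e)"
  proof (rule suminf_le)
    fix n
    show "norm (weight n x *\<^sub>R (f (p n) - c)) \<le> weight n x * e"
    proof (cases "d x (p n) < 2 * \<delta> x")
      case True
      then show ?thesis using close[of n] weight_nonneg[of n x] by (simp add: mult_left_mono)
    next
      case False
      then show ?thesis by (simp add: weight_def)
    qed
  qed (use wsum_uniform(2)[of "\<lambda>y. f y - c" "C + norm c" x, OF C'] in
      \<open>auto intro: summable_mult2 summable_weight\<close>)
  also have "\<dots> = total_weight x * e"
    unfolding total_weight_def by (rule suminf_mult2[symmetric, OF summable_weight])
  finally have le: "norm (wsum f x - total_weight x *\<^sub>R c) \<le> total_weight x * e" .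
  have eq: "extend f x - c = (wsum f x - total_weight x *\<^sub>R c) /\<^sub>R total_weight x"
    using x total_pos[OF x] by (simp add: extend_def scaleR_diff_right)
  have "inverse (total_weight x) * norm (wsum f x - total_weight x *\<^sub>R c)
      \<le> inverse (total_weight x) * (total_weight x * e)"
    using le total_pos[OF x] by (intro mult_left_mono) auto
  then show ?thesis
    unfolding eq norm_scaleR using total_pos[OF x] by (simp flip: mult.assoc)
qed

text \<open>
  Off \<open>D\<close> the extension is a quotient of uniformly convergent series. If \<open>x\<^sub>0 \<in> D\<close> and \<open>d x\<^sub>0 y < r/3\<close>, then
  the points used for the mean at \<open>y\<close> have distance less than \<open>2 r/3\<close> from \<open>y\<close>, hence less than \<open>r\<close> from
  \<open>x\<^sub>0\<close>, where \<open>f\<close> is close to \<open>f x\<^sub>0\<close>.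
\<close>

lemma continuous_on_extend:
  fixes f :: "'a \<Rightarrow> 'b::banach"
  assumes f: "continuous_on UNIV f"
  shows "continuous_on UNIV (extend f)"
proof -
  have "bounded (range f)"
    using compact_continuous_image[OF f compact_UNIV] by (rule compact_imp_bounded)
  then obtain C where C: "\<And>x. norm (f x) \<le> C" by (auto simp: bounded_iff)
  have "(extend f \<longlongrightarrow> extend f x) (at x)" for x
  proof (cases "x \<in> D")
    case False
    have "continuous_on (- D) (\<lambda>x. wsum f x /\<^sub>R total_weight x)"
      using total_pos wsum_uniform(1)[of f C] C continuous_on_total
      by (intro continuous_intros) (auto intro: continuous_on_subset simp: less_imp_neq[symmetric])
    then have "continuous_on (- D) (extend f)"
      by (rule continuous_on_eq) (simp add: extend_def)
    with False have "(extend f \<longlongrightarrow> extend f x) (at x within - D)"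
      by (auto simp: continuous_on_def)
    then show ?thesis
      using False closed_D at_within_open[of x "- D"] by (simp add: open_Compl)
  next
    case True
    show ?thesis
      unfolding tendsto_iff
    proof (intro allI impI)
      fix e :: real assume e: "e > 0"
      have "open (f -` ball (f x) (e/2))"
        using f by (simp add: continuous_on_open_vimage open_vimage)
      then obtain r where r: "r > 0" and ball: "\<And>y. d x y < r \<Longrightarrow> y \<in> f -` ball (f x) (e/2)"
        by (rule open_contains_metric_ball[of _ x]) (use e in auto)
      have near: "norm (f y - f x) \<le> e/2" if "d x y < r" for y
        using ball[OF that] by (simp add: dist_norm norm_minus_commute[of "f x"])
      have "norm (extend f y - f x) \<le> e/2" if y: "d x y < r/3" for y
      proof (cases "y \<in> D")
        case True
        then show ?thesis using r near[of y] y \<open>x \<in> D\<close> by (simp add: extend_def)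
      next
        case False
        have "norm (f (p n) - f x) \<le> e/2" if "d y (p n) < 2 * \<delta> y" for n
        proof (rule near)
          \<comment> \<open>Points of positive weight lie within twice the distance from \<open>y\<close> to \<open>D\<close>.\<close>
          show "d x (p n) < r"
            using that delta_le_dist[OF \<open>x \<in> D\<close>, of y] dist_triangle[of x "p n" y] y commute[of x y]
            by linarith
        qed
        then show ?thesis using extend_close[OF False, of f C] C by blast
      qed
      moreover have "extend f x = f x" using True by (simp add: extend_def)
      ultimately have "dist (extend f y) (extend f x) < e" if "d x y < r/3" for y
        using that e by (fastforce simp: dist_norm)
      then show "eventually (\<lambda>y. dist (extend f y) (extend f x) < e) (at x)"
        using r by (intro eventually_mono[OF eventually_metric_ball[of "r/3" x]]) auto
    qed
  qed
  then show ?thesis by (simp add: continuous_on_def)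
qed

lemma summable_weighted:
  fixes f :: "'a \<Rightarrow> 'b::banach"
  assumes "continuous_on UNIV f"
  shows "summable (\<lambda>n. weight n x *\<^sub>R f (p n))"
proof -
  have "bounded (range f)"
    using compact_continuous_image[OF assms compact_UNIV] by (rule compact_imp_bounded)
  then obtain C where "\<And>x. norm (f x) \<le> C" by (auto simp: bounded_iff)
  then show ?thesis by (intro summable_norm_cancel[OF wsum_uniform(2)])
qed

lemma extend_add:
  fixes f g :: "'a \<Rightarrow> 'b::banach"
  assumes "continuous_on UNIV f" "continuous_on UNIV g"
  shows "extend (\<lambda>x. f x + g x) x = extend f x + extend g x"
proof -
  have "wsum (\<lambda>x. f x + g x) x = wsum f x + wsum g x"
    unfolding wsum_def scaleR_add_right
    by (rule suminf_add[symmetric]) (intro summable_weighted assms)+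
  then show ?thesis by (simp add: extend_def scaleR_add_right)
qed

text \<open>
  Used with multiplication by a scalar as \<open>L\<close>, it shows that the extension is linear over the scalar
  field.
\<close>

lemma extend_bounded_linear:
  assumes "continuous_on UNIV f" "bounded_linear L"
  shows "extend (\<lambda>x. L (f x)) x = L (extend f x)"
proof -
  interpret L: bounded_linear L by fact
  show ?thesis
    by (simp add: extend_def wsum_def L.scaleR L.suminf[OF summable_weighted[OF assms(1)]])
qed

end

text \<open>
  The last property with \<open>c = 0\<close> says that \<open>E f\<close> depends only on the values of \<open>f\<close> on \<open>D\<close>, so \<open>E\<close> acts on
  restrictions to \<open>D\<close>. If \<open>D\<close> is empty, \<open>E = 0\<close>.
\<close>

theorem linear_extension_operator:
  fixes D :: "'a::topological_space set"
  assumes comp: "compact (UNIV :: 'a set)" and metr: "metrizable_space (euclidean :: 'a topology)"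
    and D: "closed D"
  shows "\<exists>E :: ('a \<Rightarrow>\<^sub>C 'k::{real_normed_field, banach}) \<Rightarrow> ('a \<Rightarrow>\<^sub>C 'k).
    Vector_Spaces.linear bcontfun_scale bcontfun_scale E \<and>
    (\<forall>f. \<forall>x\<in>D. apply_bcontfun (E f) x = apply_bcontfun f x) \<and>
    (\<forall>f. \<forall>c\<ge>0. (\<forall>x\<in>D. norm (apply_bcontfun f x) \<le> c) \<longrightarrow> norm (E f) \<le> c)"
proof -
  interpret X: normed_space_over "bcontfun_scale :: 'k \<Rightarrow> ('a \<Rightarrow>\<^sub>C 'k) \<Rightarrow> _"
    by (rule normed_space_over_bcontfun_scale)
  interpret XX: vector_space_pair
    "bcontfun_scale :: 'k \<Rightarrow> ('a \<Rightarrow>\<^sub>C 'k) \<Rightarrow> _" "bcontfun_scale :: 'k \<Rightarrow> ('a \<Rightarrow>\<^sub>C 'k) \<Rightarrow> _" ..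
  show ?thesis
  proof (cases "D = {}")
    case True
    show ?thesis
      using XX.linear_zero True by (intro exI[of _ "\<lambda>_. 0"]) auto
  next
    case False
    obtain M d where Md: "Metric_space M d" "(euclidean :: 'a topology) = Metric_space.mtopology M d"
      using metr unfolding metrizable_space_def by blast
    have "M = UNIV"
      using Metric_space.topspace_mtopology[OF Md(1)] Md(2) by (metis topspace_euclidean)
    then interpret metrized d
      using Md by (simp add: metrized_def metrized_axioms_def)
    have "compact D" using compact_Int_closed[OF comp D] by simp
    from compact_dense_sequence[OF this False]
    obtain p :: "nat \<Rightarrow> 'a" where p: "range p \<subseteq> D" "\<forall>x\<in>D. \<forall>e>0. \<exists>n. d x (p n) < e"
      by blast
    interpret dense_in_closed d D p
    proof unfold_locales
      show "p n \<in> D" for n using p(1) by auto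
      show "\<exists>n. d x (p n) < e" if "x \<in> D" "e > 0" for x e
        using p(2) that by simp
    qed (fact comp D)+
    define E where "E f = Bcontfun (extend (apply_bcontfun f))" for f :: "'a \<Rightarrow>\<^sub>C 'k"
    have cont: "continuous_on UNIV (apply_bcontfun f)" for f :: "'a \<Rightarrow>\<^sub>C 'k" by simp
    have E: "apply_bcontfun (E f) = extend f" for f
    proof -
      have "bounded (range (extend (apply_bcontfun f)))"
        using continuous_on_extend[OF cont] comp
        by (intro compact_imp_bounded compact_continuous_image)
      then show ?thesis
        using continuous_on_extend[OF cont] by (simp add: E_def bcontfun_def Bcontfun_inverse)
    qed
    show ?thesis
    proof (intro exI[of _ E] conjI allI ballI impI)
      show "Vector_Spaces.linear bcontfun_scale bcontfun_scale E"
      proof (unfold Vector_Spaces.linear_iff, intro conjI allI X.vector_space_axioms)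
        show "E (f + g) = E f + E g" for f g
          using extend_add[OF cont cont, of f g]
          by (intro bcontfun_eqI) (simp add: E plus_bcontfun.rep_eq)
        have "apply_bcontfun (bcontfun_scale a f) = (\<lambda>x. a * f x)" for a and f :: "'a \<Rightarrow>\<^sub>C 'k"
          by (rule ext) (rule apply_bcontfun_scale)
        then show "E (bcontfun_scale a f) = bcontfun_scale a (E f)" for a f
          using extend_bounded_linear[OF cont[of f] bounded_linear_mult_right[of a]]
          by (intro bcontfun_eqI) (simp only: E)
      qed
      show "apply_bcontfun (E f) x = apply_bcontfun f x" if "x \<in> D" for f x
        using that by (simp add: E extend_def)
      show "norm (E f) \<le> c" if fc: "0 \<le> c" "\<forall>x\<in>D. norm (apply_bcontfun f x) \<le> c" for f c
      proof (rule norm_bound)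
        fix x
        show "norm (E f x) \<le> c"
        proof (cases "x \<in> D")
          case True
          then show ?thesis using fc by (simp add: E extend_def)
        next
          case False
          then show ?thesis
            using extend_close[OF False, of f c 0 c] fc p_in by (simp add: E)
        qed
      qed
    qed
  qed
qed


section \<open>Lifting operators through a quotient\<close>

text \<open>
  Such an \<open>E\<close> induces a linear right inverse of the quotient map. It preserves norms: any \<open>z\<close> in the coset
  of \<open>x\<close> has \<open>E z = E x\<close>, so \<open>\<parallel>E x\<parallel> \<le> \<parallel>z\<parallel>\<close>, and \<open>E x\<close> itself belongs to that coset. Hence the image
  \<open>T y\<close> under \<open>E\<close> of any representative of \<open>S y\<close> satisfies \<open>\<parallel>T y\<parallel> = \<parallel>S y\<parallel>\<close> for each \<open>y\<close>.
\<close>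

theorem QLP_if_contractive_lifting:
  fixes s :: "'k::real_normed_field \<Rightarrow> 'x::real_normed_vector \<Rightarrow> 'x"
  assumes s: "normed_space_over s" and J: "module.subspace s J"
    and E: "Vector_Spaces.linear s s E" and kills: "\<And>j. j \<in> J \<Longrightarrow> E j = 0"
    and lifts: "\<And>x. E x - x \<in> J" and contr: "\<And>x. norm (E x) \<le> norm x"
  shows "QLP TYPE('y::banach) s J"
  unfolding QLP_def
proof (intro allI impI)
  fix sY :: "'k \<Rightarrow> 'y \<Rightarrow> 'y" and S
  assume "normed_space_over sY \<and> bounded_linear_to_quot sY s J S"
  then have sY: "normed_space_over sY" and S: "bounded_linear_to_quot sY s J S" by auto
  interpret X: normed_space_over s by fact
  interpret Y: normed_space_over sY by fact
  interpret E: Vector_Spaces.linear s s E by fact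
  have in_coset: "z \<in> x +o J \<longleftrightarrow> z - x \<in> J" for x z
    unfolding elt_set_plus_def by (auto intro!: bexI[of _ "z - x"])
  have coset_eq: "x +o J = z +o J \<longleftrightarrow> x - z \<in> J" for x z
  proof
    assume "x +o J = z +o J"
    then show "x - z \<in> J"
      using in_coset[of x x] in_coset[of x z] X.subspace_0[OF J] by simp
  next
    assume xz: "x - z \<in> J"
    have "w - x \<in> J \<longleftrightarrow> w - z \<in> J" for w
      using X.subspace_add[OF J _ xz, of "w - x"] X.subspace_diff[OF J _ xz, of "w - z"] by auto
    then show "x +o J = z +o J" by (auto simp: in_coset)
  qed
  have "\<exists>x. S y = x +o J" for y
    using S unfolding bounded_linear_to_quot_def quot_carrier_def by blast
  then have "\<exists>R. \<forall>y. S y = R y +o J" by (intro choice allI)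
  then obtain R where R: "\<And>y. S y = R y +o J" by (elim exE) simp
  define T where "T y = E (R y)" for y
  have T: "T y = E x" if "S y = x +o J" for x y
  proof -
    have "R y +o J = x +o J" using R that by (rule trans[OF sym])
    then have "R y - x \<in> J" by (simp only: coset_eq)
    then show ?thesis using kills[of "R y - x"] by (simp add: T_def E.diff)
  qed
  have T_add: "T (y + z) = T y + T z" for y z
  proof -
    have "S (y + z) = (R y + R z) +o J"
      using S R quot_add_coset[OF X.module_axioms J] by (simp add: bounded_linear_to_quot_def)
    from T[OF this] show ?thesis by (simp only: E.add T_def[of y] T_def[of z])
  qed
  have T_scale: "T (sY a y) = s a (T y)" for a y
  proof -
    have "S (sY a y) = s a (R y) +o J"
      using S R quot_scale_coset[OF X.module_axioms J] by (simp add: bounded_linear_to_quot_def)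
    from T[OF this] show ?thesis by (simp only: E.scale T_def[of y])
  qed
  have T_lift: "T y +o J = S y" for y
    using lifts[of "R y"] by (simp add: R coset_eq T_def)
  have T_norm: "norm (T y) = quot_norm (S y)" for y
  proof (rule antisym)
    have mem: "T y \<in> S y"
      using lifts[of "R y"] by (simp add: R in_coset T_def)
    have "norm (T y) \<le> norm z" if "z \<in> S y" for z
    proof -
      have "z - R y \<in> J" using that by (simp only: R in_coset)
      then have "S y = z +o J" by (simp only: R flip: coset_eq)
      from T[OF this] show ?thesis using contr[of z] by (simp only:)
    qed
    then show "norm (T y) \<le> quot_norm (S y)"
      unfolding quot_norm_def using mem by (intro cINF_greatest) auto
    show "quot_norm (S y) \<le> norm (T y)"
      unfolding quot_norm_def using mem by (intro cINF_lower) (auto intro!: bdd_belowI[of _ 0])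
  qed
  have "bounded_linear T"
  proof -
    obtain K where "\<And>y. quot_norm (S y) \<le> norm y * K"
      using S by (auto simp: bounded_linear_to_quot_def)
    then show ?thesis
      using T_add T_scale[of "of_real _"]
      by (intro bounded_linear_intro[of _ K]) (auto simp: T_norm X.scale_of_real Y.scale_of_real)
  qed
  moreover have "Vector_Spaces.linear sY s T"
    using T_add T_scale by (simp add: Vector_Spaces.linear_iff X.vector_space_axioms Y.vector_space_axioms)
  moreover have "onorm T = quot_onorm S"
    by (simp add: onorm_def quot_onorm_def T_norm)
  ultimately show "\<exists>T. bounded_linear T \<and> Vector_Spaces.linear sY s T \<and>
            (\<forall>y. T y +o J = S y) \<and> onorm T = quot_onorm S"
    using T_lift by blast
qed

text \<open>
  With \<open>D\<close> the common zero set of \<open>J\<close>, the extension operator kills \<open>J\<close> since functions in \<open>J\<close> vanish on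
  \<open>D\<close>, and \<open>E f - f\<close> belongs to \<open>J\<close> since it vanishes on \<open>D\<close>.
\<close>

lemma (in real_or_complex) QLP_if_M_ideal:
  fixes J :: "('a::topological_space \<Rightarrow>\<^sub>C 'k) set"
  assumes comp: "compact (UNIV :: 'a set)" and metr: "metrizable_space (euclidean :: 'a topology)"
    and J: "M_ideal bcontfun_scale J"
  shows "QLP TYPE('y::banach) bcontfun_scale J"
proof -
  define D where "D = {x. \<forall>g\<in>J. apply_bcontfun g x = 0}"
  have sub: "module.subspace bcontfun_scale J" "closed J"
    using J by (auto simp: M_ideal_def)
  have J_iff: "f \<in> J \<longleftrightarrow> (\<forall>x\<in>D. apply_bcontfun f x = 0)" for f
  proof
    assume f: "\<forall>x\<in>D. apply_bcontfun f x = 0"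
    show "f \<in> J"
    proof (rule closed_ideal_eq_vanishing[OF comp sub])
      show "bcontfun_mult h g \<in> J" if "g \<in> J" for h g
        using J that by (rule M_ideal_imp_ideal)
      show "apply_bcontfun f x = 0" if "\<And>g. g \<in> J \<Longrightarrow> apply_bcontfun g x = 0" for x
        using f that unfolding D_def by blast
    qed
  qed (simp add: D_def)
  have "D = (\<Inter>g\<in>J. {x. apply_bcontfun g x = 0})"
    by (auto simp: D_def)
  moreover have "closed {x. apply_bcontfun g x = 0}" for g :: "'a \<Rightarrow>\<^sub>C 'k"
    by (intro closed_Collect_eq continuous_on_apply_bcontfun continuous_on_const)
  ultimately have "closed D" by (simp add: closed_INT)
  from linear_extension_operator[OF comp metr this]
  obtain E :: "('a \<Rightarrow>\<^sub>C 'k) \<Rightarrow> ('a \<Rightarrow>\<^sub>C 'k)"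
    where E: "Vector_Spaces.linear bcontfun_scale bcontfun_scale E"
      and E_on: "\<forall>f. \<forall>x\<in>D. apply_bcontfun (E f) x = apply_bcontfun f x"
      and E_norm: "\<forall>f. \<forall>c\<ge>0. (\<forall>x\<in>D. norm (apply_bcontfun f x) \<le> c) \<longrightarrow> norm (E f) \<le> c"
    by blast
  show ?thesis
  proof (rule QLP_if_contractive_lifting[OF normed_space_over_bcontfun_scale sub(1) E])
    show "E j = 0" if "j \<in> J" for j
      using E_norm[rule_format, of 0 j] that by (simp add: J_iff)
    show "E f - f \<in> J" for f
      by (simp add: J_iff E_on)
    show "norm (E f) \<le> norm f" for f
      by (rule E_norm[rule_format]) (simp_all add: norm_bounded)
  qed
qed

theorem proposition23:
  assumes "compact_space (euclidean :: 'a::topological_space topology)"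
    and "metrizable_space (euclidean :: 'a topology)"
  shows
    "(\<forall>J :: ('a \<Rightarrow>\<^sub>C real) set.
        M_ideal bcontfun_scale J \<longrightarrow> QLP TYPE('y::banach) bcontfun_scale J) \<and>
     (\<forall>J :: ('a \<Rightarrow>\<^sub>C complex) set.
        M_ideal bcontfun_scale J \<longrightarrow> QLP TYPE('y) bcontfun_scale J)"
proof -
  interpret R: real_or_complex "\<lambda>x :: real. x" "\<lambda>_. 0" 0
  proof (rule real_or_complex.intro)
    show "bounded_linear (\<lambda>x :: real. x)" "bounded_linear (\<lambda>_ :: real. 0 :: real)"
      by (rule bounded_linear_ident bounded_linear_zero)+
  qed (simp_all add: power2_eq_square)
  interpret C: real_or_complex Re Im \<i>
  proof (rule real_or_complex.intro)
    show "z = of_real (Re z) + \<i> * of_real (Im z)" for z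
      by (rule complex_eq)
    show "z * (of_real (Re z) - \<i> * of_real (Im z)) = of_real ((norm z)\<^sup>2)" for z
      unfolding cmod_power2 by (simp add: complex_eq_iff power2_eq_square)
  qed (simp_all add: bounded_linear_Re bounded_linear_Im)
  have "compact (UNIV :: 'a set)"
    using assms(1) by (simp add: compact_space_def)
  with assms(2) show ?thesis
    using R.QLP_if_M_ideal C.QLP_if_M_ideal by (intro conjI allI impI)
qed

end
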